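(* Let $\mathcal{H}$ be a nonzero complex Hilbert space. Suppose that $U\in\boldsymbol{B}(\ell_2(\mathbb{Z},\mathcal{H}))$ is a unitary operator that has exactly two nonzero diagonals, all other elements of its matrix being zero operators; that is, there are integers $k_1\ne k_2$ such that $U_{n,n+k_1}\neq 0$ and $U_{n,n+k_2}\ne 0$ for all $n\in\mathbb{Z}$, and $U_{i,j}=0$ whenever $j-i\notin\{k_1,k_2\}$. Then for every $n\in\mathbb{Z}$ the operators $U_{n,n+k_1}$ and $U_{n,n+k_2}$ are partial isometries, and their ranges are orthogonal to each other.
   Context: $\boldsymbol{B}(\mathcal{K})$ is the algebra of bounded linear operators on a Hilbert space $\mathcal{K}$. $\ell_2(\mathbb{Z},\mathcal{H})=\bigoplus_{n\in\mathbb{Z}}\mathcal{H}$ is the Hilbert space of two-sided sequences $x=(x_n)_{n\in\mathbb{Z}}$ in $\mathcal{H}$ with $\sum_{n}\|x_n\|^2<\infty$. Every $U\in\boldsymbol{B}(\ell_2(\mathbb{Z},\mathcal{H}))$ is identified with its operator matrix $[U_{i,j}]_{i,j\in\mathbb{Z}}$, $U_{i,j}\in\boldsymbol{B}(\mathcal{H})$, where $(Ux)_i=\sum_j U_{i,j}x_j$. An operator $A\in\boldsymbol{B}(\mathcal{H})$ is a partial isometry if $\|Ax\|=\|x\|$ for all $x$ in the orthogonal complement of the kernel of $A$. *)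

theory Defs
  imports "HOL-Analysis.Analysis"
begin

section \<open>Complex Hilbert spaces\<close>

text \<open>
  The inner product is linear in the first argument. The real scalar multiplication inherited from
  the class \<^class>\<open>real_normed_vector\<close> is required to be the restriction of the complex one,
  so it carries no extra information. Positive definiteness of the inner product follows from
  \<open>cinner_self\<close>.
\<close>

class complex_inner = real_normed_vector +
  fixes scaleC :: "complex \<Rightarrow> 'a \<Rightarrow> 'a"  (infixr "*\<^sub>C" 75)
    and cinner :: "'a \<Rightarrow> 'a \<Rightarrow> complex"
  assumes scaleC_add_right: "c *\<^sub>C (x + y) = c *\<^sub>C x + c *\<^sub>C y"
    and scaleC_add_left: "(c + d) *\<^sub>C x = c *\<^sub>C x + d *\<^sub>C x"
    and scaleC_scaleC [simp]: "c *\<^sub>C d *\<^sub>C x = (c * d) *\<^sub>C x"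
    and scaleC_one [simp]: "1 *\<^sub>C x = x"
    and scaleR_scaleC: "r *\<^sub>R x = complex_of_real r *\<^sub>C x"
    and cinner_commute: "cinner x y = cnj (cinner y x)"
    and cinner_add_left: "cinner (x + y) z = cinner x z + cinner y z"
    and cinner_scaleC_left [simp]: "cinner (c *\<^sub>C x) y = c * cinner x y"
    and cinner_self: "cinner x x = complex_of_real ((norm x)\<^sup>2)"

class chilbert_space = complex_inner + banach

instantiation complex :: chilbert_space
begin

definition scaleC_complex :: "complex \<Rightarrow> complex \<Rightarrow> complex"
  where "scaleC_complex c x = c * x"

definition cinner_complex :: "complex \<Rightarrow> complex \<Rightarrow> complex"
  where "cinner_complex x y = x * cnj y"

instance
  by standard
    (auto simp: scaleC_complex_def cinner_complex_def algebra_simps scaleR_conv_of_real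
      simp flip: complex_norm_square)

end

lemma cinner_add_right: "cinner x (y + z) = cinner x y + cinner x z"
  for x y z :: "'a::complex_inner"
  by (metis cinner_commute cinner_add_left complex_cnj_add)

lemma cinner_scaleC_right [simp]: "cinner x (c *\<^sub>C y) = cnj c * cinner x y"
  for x y :: "'a::complex_inner"
  by (metis cinner_commute cinner_scaleC_left complex_cnj_mult)

lemma norm_scaleC [simp]: "norm (c *\<^sub>C x) = cmod c * norm x"
  for x :: "'a::complex_inner"
proof -
  have "complex_of_real ((norm (c *\<^sub>C x))\<^sup>2) = (c * cnj c) * complex_of_real ((norm x)\<^sup>2)"
    by (simp only: cinner_self [symmetric] cinner_scaleC_left cinner_scaleC_right mult_ac)
  also have "\<dots> = complex_of_real ((cmod c * norm x)\<^sup>2)"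
    by (simp only: complex_norm_square [symmetric] power_mult_distrib of_real_mult)
  finally have "complex_of_real ((norm (c *\<^sub>C x))\<^sup>2) = complex_of_real ((cmod c * norm x)\<^sup>2)" .
  then have "(norm (c *\<^sub>C x))\<^sup>2 = (cmod c * norm x)\<^sup>2"
    using of_real_eq_iff by blast
  then show ?thesis
    by (simp add: power2_eq_iff_nonneg)
qed

lemma cinner_bound: "2 * cmod (cinner x y) \<le> (norm x)\<^sup>2 + (norm y)\<^sup>2"
  for x y :: "'a::complex_inner"
proof -
  define c where "c = - sgn (cinner x y)"
  define z where "z = cinner x (c *\<^sub>C y)"
  have z: "z = - complex_of_real (cmod (cinner x y))"
  proof (cases "cinner x y = 0")
    case False
    have "z * complex_of_real (cmod (cinner x y)) = - (cinner x y * cnj (cinner x y))"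
      using False by (simp add: z_def c_def sgn_div_norm scaleR_conv_of_real field_simps)
    also have "\<dots> = - complex_of_real (cmod (cinner x y)) * complex_of_real (cmod (cinner x y))"
      by (simp only: complex_norm_square [symmetric] power2_eq_square of_real_mult mult_minus_left)
    finally show ?thesis
      using False by (simp only: mult_cancel_right of_real_eq_0_iff norm_eq_zero) simp
  qed (simp add: z_def)
  have "complex_of_real ((norm (x + c *\<^sub>C y))\<^sup>2)
      = complex_of_real ((norm x)\<^sup>2 + (norm (c *\<^sub>C y))\<^sup>2) + (z + cnj z)"
    by (simp only: cinner_self [symmetric] cinner_add_left cinner_add_right of_real_add z_def
      cinner_commute [of "c *\<^sub>C y" x] add_ac)
  also have "\<dots> = complex_of_real ((norm x)\<^sup>2 + (norm (c *\<^sub>C y))\<^sup>2 - 2 * cmod (cinner x y))"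
    by (simp add: z)
  finally have "complex_of_real ((norm (x + c *\<^sub>C y))\<^sup>2)
      = complex_of_real ((norm x)\<^sup>2 + (norm (c *\<^sub>C y))\<^sup>2 - 2 * cmod (cinner x y))" .
  then have "(norm (x + c *\<^sub>C y))\<^sup>2 = (norm x)\<^sup>2 + (norm (c *\<^sub>C y))\<^sup>2 - 2 * cmod (cinner x y)"
    using of_real_eq_iff by blast
  moreover have "(norm (c *\<^sub>C y))\<^sup>2 \<le> (norm y)\<^sup>2"
    by (simp add: c_def norm_sgn)
  ultimately show ?thesis
    using zero_le_power2 [of "norm (x + c *\<^sub>C y)"] by linarith
qed


section \<open>Bounded operators\<close>

definition bounded_clinear :: "('a::complex_inner \<Rightarrow> 'b::complex_inner) \<Rightarrow> bool"
  where "bounded_clinear A \<longleftrightarrow> bounded_linear A \<and> (\<forall>c x. A (c *\<^sub>C x) = c *\<^sub>C A x)"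

definition is_adjoint :: "('a::complex_inner \<Rightarrow> 'b::complex_inner) \<Rightarrow> ('b \<Rightarrow> 'a) \<Rightarrow> bool"
  where "is_adjoint A B \<longleftrightarrow> (\<forall>x y. cinner (A x) y = cinner x (B y))"

definition unitary_op :: "('a::complex_inner \<Rightarrow> 'a) \<Rightarrow> bool"
  where "unitary_op U \<longleftrightarrow> bounded_clinear U \<and>
    (\<exists>V. bounded_clinear V \<and> is_adjoint U V \<and> V \<circ> U = id \<and> U \<circ> V = id)"

definition op_kernel :: "('a::complex_inner \<Rightarrow> 'b::complex_inner) \<Rightarrow> 'a set"
  where "op_kernel A = {x. A x = 0}"

definition orth_sets :: "'a::complex_inner set \<Rightarrow> 'a set \<Rightarrow> bool"
  where "orth_sets S T \<longleftrightarrow> (\<forall>x\<in>S. \<forall>y\<in>T. cinner x y = 0)"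

definition orth_complement :: "'a::complex_inner set \<Rightarrow> 'a set"
  where "orth_complement S = {x. \<forall>y\<in>S. cinner x y = 0}"

definition partial_isometry :: "('a::complex_inner \<Rightarrow> 'b::complex_inner) \<Rightarrow> bool"
  where "partial_isometry A \<longleftrightarrow> bounded_clinear A \<and>
    (\<forall>x \<in> orth_complement (op_kernel A). norm (A x) = norm x)"


section \<open>Two-sided square-summable sequences\<close>

typedef (overloaded) ('a::complex_inner) ell2Z =
  "{x :: int \<Rightarrow> 'a. (\<lambda>n. (norm (x n))\<^sup>2) summable_on UNIV}"
  morphisms coord Abs_ell2Z
  by (rule exI [of _ "\<lambda>_. 0"]) simp

setup_lifting type_definition_ell2Z

lemma coord_summable: "(\<lambda>n. (norm (coord x n))\<^sup>2) summable_on UNIV"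
  using coord [of x] by simp

lemma ell2Z_eqI: "(\<And>n. coord x n = coord y n) \<Longrightarrow> x = y"
  by (simp add: ext flip: coord_inject)

lemma square_summable_add:
  fixes x y :: "int \<Rightarrow> 'a::real_normed_vector"
  assumes "(\<lambda>n. (norm (x n))\<^sup>2) summable_on UNIV" "(\<lambda>n. (norm (y n))\<^sup>2) summable_on UNIV"
  shows "(\<lambda>n. (norm (x n + y n))\<^sup>2) summable_on UNIV"
proof (rule summable_on_comparison_test)
  show "(\<lambda>n. 2 * (norm (x n))\<^sup>2 + 2 * (norm (y n))\<^sup>2) summable_on UNIV"
    by (intro summable_on_add summable_on_cmult_right assms)
  fix n
  have "(norm (x n + y n))\<^sup>2 \<le> (norm (x n) + norm (y n))\<^sup>2"
    by (intro power_mono norm_triangle_ineq) simp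
  also have "\<dots> \<le> 2 * (norm (x n))\<^sup>2 + 2 * (norm (y n))\<^sup>2"
    using zero_le_power2 [of "norm (x n) - norm (y n)"] by (simp add: power2_eq_square algebra_simps)
  finally show "(norm (x n + y n))\<^sup>2 \<le> 2 * (norm (x n))\<^sup>2 + 2 * (norm (y n))\<^sup>2" .
qed simp_all

lemma square_summable_bounded:
  fixes x :: "int \<Rightarrow> 'a::real_normed_vector"
  assumes "\<And>F. finite F \<Longrightarrow> L2_set (\<lambda>n. norm (x n)) F \<le> K"
  shows "(\<lambda>n. (norm (x n))\<^sup>2) summable_on UNIV"
proof (rule nonneg_bdd_above_summable_on)
  show "bdd_above (sum (\<lambda>n. (norm (x n))\<^sup>2) ` {F. F \<subseteq> UNIV \<and> finite F})"
  proof (rule bdd_aboveI2)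
    fix F :: "int set" assume "F \<in> {F. F \<subseteq> UNIV \<and> finite F}"
    then have "(L2_set (\<lambda>n. norm (x n)) F)\<^sup>2 \<le> K\<^sup>2"
      using assms by (intro power_mono) auto
    then show "(\<Sum>n\<in>F. (norm (x n))\<^sup>2) \<le> K\<^sup>2"
      by (simp add: L2_set_def sum_nonneg)
  qed
qed simp

instantiation ell2Z :: (complex_inner) complex_inner
begin

lift_definition zero_ell2Z :: "'a ell2Z" is "\<lambda>_. 0" by simp

lift_definition plus_ell2Z :: "'a ell2Z \<Rightarrow> 'a ell2Z \<Rightarrow> 'a ell2Z" is "\<lambda>x y n. x n + y n"
  by (rule square_summable_add)

lift_definition uminus_ell2Z :: "'a ell2Z \<Rightarrow> 'a ell2Z" is "\<lambda>x n. - x n" by simp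

lift_definition minus_ell2Z :: "'a ell2Z \<Rightarrow> 'a ell2Z \<Rightarrow> 'a ell2Z" is "\<lambda>x y n. x n - y n"
  subgoal for x y using square_summable_add [of x "\<lambda>n. - y n"] by simp
  done

lift_definition scaleC_ell2Z :: "complex \<Rightarrow> 'a ell2Z \<Rightarrow> 'a ell2Z" is "\<lambda>c x n. c *\<^sub>C x n"
  by (simp add: power_mult_distrib summable_on_cmult_right)

lift_definition scaleR_ell2Z :: "real \<Rightarrow> 'a ell2Z \<Rightarrow> 'a ell2Z" is "\<lambda>r x n. r *\<^sub>R x n"
  by (simp add: power_mult_distrib summable_on_cmult_right)

definition cinner_ell2Z :: "'a ell2Z \<Rightarrow> 'a ell2Z \<Rightarrow> complex"
  where "cinner_ell2Z x y = (\<Sum>\<^sub>\<infinity>n. cinner (coord x n) (coord y n))"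

definition norm_ell2Z :: "'a ell2Z \<Rightarrow> real"
  where "norm_ell2Z x = sqrt (\<Sum>\<^sub>\<infinity>n. (norm (coord x n))\<^sup>2)"

definition sgn_ell2Z :: "'a ell2Z \<Rightarrow> 'a ell2Z"
  where "sgn_ell2Z x = inverse (norm x) *\<^sub>R x"

definition dist_ell2Z :: "'a ell2Z \<Rightarrow> 'a ell2Z \<Rightarrow> real"
  where "dist_ell2Z x y = norm (x - y)"

definition uniformity_ell2Z :: "('a ell2Z \<times> 'a ell2Z) filter"
  where "uniformity_ell2Z = (INF e\<in>{0 <..}. principal {(x, y). dist x y < e})"

definition open_ell2Z :: "'a ell2Z set \<Rightarrow> bool"
  where "open_ell2Z S \<longleftrightarrow> (\<forall>x\<in>S. \<forall>\<^sub>F (x', y) in uniformity. x' = x \<longrightarrow> y \<in> S)"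

lemmas coord_simps = zero_ell2Z.rep_eq plus_ell2Z.rep_eq uminus_ell2Z.rep_eq minus_ell2Z.rep_eq
  scaleC_ell2Z.rep_eq scaleR_ell2Z.rep_eq

lemma norm_ell2Z_squared: "(norm x)\<^sup>2 = (\<Sum>\<^sub>\<infinity>n. (norm (coord x n))\<^sup>2)"
  for x :: "'a ell2Z"
  by (simp add: norm_ell2Z_def infsum_nonneg)

lemma norm_ell2Z_nonneg: "0 \<le> norm x"
  for x :: "'a ell2Z"
  by (simp add: norm_ell2Z_def infsum_nonneg)

lemma L2_set_le_norm_ell2Z: "finite F \<Longrightarrow> L2_set (\<lambda>n. norm (coord x n)) F \<le> norm x"
  for x :: "'a ell2Z"
  unfolding L2_set_def norm_ell2Z_def
  by (intro real_sqrt_le_mono finite_sum_le_infsum coord_summable) auto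

lemma norm_coord_le: "norm (coord x n) \<le> norm x"
  for x :: "'a ell2Z"
  using L2_set_le_norm_ell2Z [of "{n}" x] by simp

lemma norm_ell2Z_leI:
  fixes x :: "'a ell2Z"
  assumes "\<And>F. finite F \<Longrightarrow> L2_set (\<lambda>n. norm (coord x n)) F \<le> K"
  shows "norm x \<le> K"
proof -
  have K: "0 \<le> K" using assms [of "{}"] by simp
  have "(\<Sum>\<^sub>\<infinity>n. (norm (coord x n))\<^sup>2) \<le> K\<^sup>2"
  proof (rule infsum_le_finite_sums [OF coord_summable])
    fix F :: "int set" assume "finite F"
    then have "(L2_set (\<lambda>n. norm (coord x n)) F)\<^sup>2 \<le> K\<^sup>2"
      using assms by (intro power_mono) auto
    then show "(\<Sum>n\<in>F. (norm (coord x n))\<^sup>2) \<le> K\<^sup>2"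
      by (simp add: L2_set_def sum_nonneg)
  qed
  then show ?thesis
    using K by (simp add: norm_ell2Z_def real_le_lsqrt infsum_nonneg)
qed

lemma cinner_summable: "(\<lambda>n. cinner (coord x n) (coord y n)) summable_on UNIV"
  for x y :: "'a ell2Z"
proof (rule Infinite_Sum.abs_summable_summable, rule Infinite_Sum.abs_summable_on_comparison_test')
  show "(\<lambda>n. (norm (coord x n))\<^sup>2 + (norm (coord y n))\<^sup>2) summable_on UNIV"
    by (intro summable_on_add coord_summable)
  show "norm (cinner (coord x n) (coord y n)) \<le> (norm (coord x n))\<^sup>2 + (norm (coord y n))\<^sup>2" for n
    using cinner_bound [of "coord x n" "coord y n"] norm_ge_zero [of "cinner (coord x n) (coord y n)"]
    by linarith
qed

instance
proof
  fix x y z :: "'a ell2Z" and a b :: real and c d :: complex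
  show "x + y + z = x + (y + z)" "x + y = y + x" "0 + x = x" "- x + x = 0" "x - y = x + - y"
    by (rule ell2Z_eqI; simp add: coord_simps)+
  show "a *\<^sub>R (x + y) = a *\<^sub>R x + a *\<^sub>R y" "(a + b) *\<^sub>R x = a *\<^sub>R x + b *\<^sub>R x"
    "a *\<^sub>R b *\<^sub>R x = (a * b) *\<^sub>R x" "1 *\<^sub>R x = x"
    by (rule ell2Z_eqI; simp add: coord_simps scaleR_add_right scaleR_add_left)+
  show "c *\<^sub>C (x + y) = c *\<^sub>C x + c *\<^sub>C y" "(c + d) *\<^sub>C x = c *\<^sub>C x + d *\<^sub>C x"
    "c *\<^sub>C d *\<^sub>C x = (c * d) *\<^sub>C x" "1 *\<^sub>C x = x" "a *\<^sub>R x = complex_of_real a *\<^sub>C x"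
    by (rule ell2Z_eqI; simp add: coord_simps scaleC_add_right scaleC_add_left scaleR_scaleC)+
  show "dist x y = norm (x - y)" by (rule dist_ell2Z_def)
  show "sgn x = inverse (norm x) *\<^sub>R x" by (rule sgn_ell2Z_def)
  show "uniformity = (INF e\<in>{0 <..}. principal {(x :: 'a ell2Z, y). dist x y < e})"
    by (rule uniformity_ell2Z_def)
  show "open S \<longleftrightarrow> (\<forall>x\<in>S. \<forall>\<^sub>F (x', y) in uniformity. x' = x \<longrightarrow> y \<in> S)" for S :: "'a ell2Z set"
    by (rule open_ell2Z_def)
  show "norm x = 0 \<longleftrightarrow> x = 0"
  proof
    assume "norm x = 0"
    then show "x = 0"
      using norm_coord_le [of x] by (intro ell2Z_eqI) (simp add: coord_simps)
  qed (simp add: norm_ell2Z_def coord_simps)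
  show "norm (x + y) \<le> norm x + norm y"
  proof (rule norm_ell2Z_leI)
    fix F :: "int set" assume F: "finite F"
    have "L2_set (\<lambda>n. norm (coord (x + y) n)) F
        \<le> L2_set (\<lambda>n. norm (coord x n) + norm (coord y n)) F"
      by (intro L2_set_mono) (simp_all add: coord_simps norm_triangle_ineq)
    also have "\<dots> \<le> L2_set (\<lambda>n. norm (coord x n)) F + L2_set (\<lambda>n. norm (coord y n)) F"
      by (rule L2_set_triangle_ineq)
    also have "\<dots> \<le> norm x + norm y"
      by (intro add_mono L2_set_le_norm_ell2Z F)
    finally show "L2_set (\<lambda>n. norm (coord (x + y) n)) F \<le> norm x + norm y" .
  qed
  show "norm (a *\<^sub>R x) = \<bar>a\<bar> * norm x"
    by (simp add: norm_ell2Z_def coord_simps power_mult_distrib infsum_cmult_right' real_sqrt_mult)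
  show "cinner x y = cnj (cinner y x)"
    unfolding cinner_ell2Z_def infsum_cnj [symmetric] by (subst cinner_commute) (rule refl)
  show "cinner (x + y) z = cinner x z + cinner y z"
    unfolding cinner_ell2Z_def coord_simps cinner_add_left
    by (intro infsum_add cinner_summable)
  show "cinner (c *\<^sub>C x) y = c * cinner x y"
    unfolding cinner_ell2Z_def coord_simps cinner_scaleC_left by (rule infsum_cmult_right')
  show "cinner x x = complex_of_real ((norm x)\<^sup>2)"
    unfolding cinner_ell2Z_def cinner_self norm_ell2Z_squared
    by (rule infsumI, rule has_sum_of_real, rule has_sum_infsum, rule coord_summable)
qed

end

instance ell2Z :: (chilbert_space) chilbert_space
proof
  fix X :: "nat \<Rightarrow> 'a ell2Z"
  assume X: "Cauchy X"
  have "Cauchy (\<lambda>k. coord (X k) n)" for n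
  proof (rule metric_CauchyI)
    fix e :: real assume "0 < e"
    then obtain M where "\<forall>m\<ge>M. \<forall>k\<ge>M. dist (X m) (X k) < e"
      using X metric_CauchyD by blast
    moreover have "dist (coord (X m) n) (coord (X k) n) \<le> dist (X m) (X k)" for m k
      using norm_coord_le [of "X m - X k" n] by (simp add: dist_norm coord_simps)
    ultimately have "\<forall>m\<ge>M. \<forall>k\<ge>M. dist (coord (X m) n) (coord (X k) n) < e"
      by (meson le_less_trans)
    then show "\<exists>M. \<forall>m\<ge>M. \<forall>k\<ge>M. dist (coord (X m) n) (coord (X k) n) < e" by blast
  qed
  then have "\<exists>l. (\<lambda>k. coord (X k) n) \<longlonglongrightarrow> l" for n
    unfolding convergent_def [symmetric] by (rule Cauchy_convergent)
  then obtain L where L: "\<And>n. (\<lambda>k. coord (X k) n) \<longlonglongrightarrow> L n"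
    by metis
  have tail: "\<exists>M. \<forall>m\<ge>M. \<forall>F. finite F \<longrightarrow> L2_set (\<lambda>n. norm (coord (X m) n - L n)) F \<le> e"
    if "0 < e" for e
  proof -
    obtain M where M: "\<And>m k. m \<ge> M \<Longrightarrow> k \<ge> M \<Longrightarrow> dist (X m) (X k) < e"
      using metric_CauchyD [OF X \<open>0 < e\<close>] by blast
    have "L2_set (\<lambda>n. norm (coord (X m) n - L n)) F \<le> e" if "m \<ge> M" "finite F" for m F
    proof (rule tendsto_upperbound)
      show "(\<lambda>k. L2_set (\<lambda>n. norm (coord (X m) n - coord (X k) n)) F)
          \<longlonglongrightarrow> L2_set (\<lambda>n. norm (coord (X m) n - L n)) F"
        unfolding L2_set_def by (intro tendsto_intros L)
      show "\<forall>\<^sub>F k in sequentially. L2_set (\<lambda>n. norm (coord (X m) n - coord (X k) n)) F \<le> e"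
      proof (rule eventually_sequentiallyI)
        fix k assume "M \<le> k"
        then have "norm (X m - X k) < e"
          using M \<open>m \<ge> M\<close> by (simp add: dist_norm)
        then show "L2_set (\<lambda>n. norm (coord (X m) n - coord (X k) n)) F \<le> e"
          using L2_set_le_norm_ell2Z [OF \<open>finite F\<close>, of "X m - X k"] by (simp add: coord_simps)
      qed
    qed simp
    then show ?thesis by blast
  qed
  obtain M where M: "\<And>F. finite F \<Longrightarrow> L2_set (\<lambda>n. norm (coord (X M) n - L n)) F \<le> 1"
    using tail [OF zero_less_one] by blast
  have "(\<lambda>n. (norm (coord (X M) n - L n))\<^sup>2) summable_on UNIV"
    using M by (rule square_summable_bounded)
  from square_summable_add [OF coord_summable [of "X M"], of "\<lambda>n. L n - coord (X M) n"] this
  have "(\<lambda>n. (norm (L n))\<^sup>2) summable_on UNIV"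
    by (simp add: norm_minus_commute)
  then have coord_L: "coord (Abs_ell2Z L) = L"
    by (simp add: Abs_ell2Z_inverse)
  have "X \<longlonglongrightarrow> Abs_ell2Z L"
  proof (rule metric_LIMSEQ_I)
    fix e :: real assume "0 < e"
    then obtain M where
      M: "\<And>m F. m \<ge> M \<Longrightarrow> finite F \<Longrightarrow> L2_set (\<lambda>n. norm (coord (X m) n - L n)) F \<le> e / 2"
      using tail [OF half_gt_zero] by blast
    have "dist (X m) (Abs_ell2Z L) < e" if "m \<ge> M" for m
    proof -
      have "norm (X m - Abs_ell2Z L) \<le> e / 2"
        using M [OF that] by (intro norm_ell2Z_leI) (simp add: coord_simps coord_L)
      then show ?thesis using \<open>0 < e\<close> by (simp add: dist_norm)
    qed
    then show "\<exists>M. \<forall>m\<ge>M. dist (X m) (Abs_ell2Z L) < e" by blast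
  qed
  then show "convergent X" by (rule convergentI)
qed


section \<open>Operator matrices\<close>

lift_definition ell2Z_single :: "int \<Rightarrow> 'a::complex_inner \<Rightarrow> 'a ell2Z"
  is "\<lambda>j v n. if n = j then v else 0"
  by (rule finite_nonzero_values_imp_summable_on, rule finite_subset [of _ "{_}"]) auto

definition entry :: "('a::complex_inner ell2Z \<Rightarrow> 'a ell2Z) \<Rightarrow> int \<Rightarrow> int \<Rightarrow> 'a \<Rightarrow> 'a"
  where "entry U i j = (\<lambda>v. coord (U (ell2Z_single j v)) i)"

lemma norm_ell2Z_single: "norm (ell2Z_single j v) = norm v"
proof -
  have "((\<lambda>n. (norm (coord (ell2Z_single j v) n))\<^sup>2) has_sum (norm v)\<^sup>2) UNIV"
    by (rule has_sum_finite_neutralI [of "{j}"]) (auto simp: ell2Z_single.rep_eq)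
  then show ?thesis
    by (simp add: norm_ell2Z_def infsumI)
qed

lemma bounded_clinear_coord: "bounded_clinear (\<lambda>x. coord x n)"
  unfolding bounded_clinear_def
  by (auto intro!: bounded_linear_intro [of _ 1] simp: coord_simps norm_coord_le)

lemma bounded_clinear_single: "bounded_clinear (ell2Z_single j)"
  unfolding bounded_clinear_def
proof (intro conjI allI)
  show "bounded_linear (ell2Z_single j :: 'a \<Rightarrow> _)"
    by (rule bounded_linear_intro [of _ 1])
      (auto intro!: ell2Z_eqI simp: coord_simps ell2Z_single.rep_eq norm_ell2Z_single)
  show "ell2Z_single j (c *\<^sub>C x) = c *\<^sub>C ell2Z_single j x" for c and x :: 'a
    using norm_scaleC [of c "0::'a"]
    by (intro ell2Z_eqI) (simp add: coord_simps ell2Z_single.rep_eq del: norm_scaleC)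
qed

lemma bounded_clinear_entry:
  assumes "bounded_clinear U"
  shows "bounded_clinear (entry U i j)"
  using assms bounded_clinear_coord [of i] bounded_clinear_single [of j]
  unfolding bounded_clinear_def entry_def
  by (auto intro: bounded_linear_compose [of "\<lambda>x. coord x i"] bounded_linear_compose [of U])

lemma single_has_sum: "((\<lambda>j. ell2Z_single j (coord x j)) has_sum x) UNIV"
proof -
  have sum_coord: "coord (\<Sum>j\<in>F. ell2Z_single j (coord x j)) n = (if n \<in> F then coord x n else 0)"
    if "finite F" for F n
    using that by induction (auto simp: coord_simps ell2Z_single.rep_eq)
  have "((\<lambda>F. \<Sum>j\<in>F. ell2Z_single j (coord x j)) \<longlongrightarrow> x) (finite_subsets_at_top UNIV)"
  proof (rule tendstoI)
    fix e :: real assume e: "0 < e"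
    define S where "S = (\<Sum>\<^sub>\<infinity>n. (norm (coord x n))\<^sup>2)"
    have S: "((\<lambda>n. (norm (coord x n))\<^sup>2) has_sum S) UNIV"
      unfolding S_def using coord_summable by (rule has_sum_infsum)
    have "\<forall>\<^sub>F F in finite_subsets_at_top UNIV. dist (\<Sum>n\<in>F. (norm (coord x n))\<^sup>2) S < e\<^sup>2"
      using S e unfolding has_sum_def by (intro tendstoD) auto
    moreover have "\<forall>\<^sub>F F in finite_subsets_at_top UNIV. finite (F :: int set)"
      by (rule eventually_finite_subsets_at_top_weakI)
    ultimately show "\<forall>\<^sub>F F in finite_subsets_at_top UNIV. dist (\<Sum>j\<in>F. ell2Z_single j (coord x j)) x < e"
    proof eventually_elim
      case (elim F)
      let ?y = "x - (\<Sum>j\<in>F. ell2Z_single j (coord x j))"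
      have "((\<lambda>n. if n \<in> F then (norm (coord x n))\<^sup>2 else 0) has_sum (\<Sum>n\<in>F. (norm (coord x n))\<^sup>2)) UNIV"
        using elim(2) by (intro has_sum_finite_neutralI [of F]) auto
      from has_sum_add [OF S has_sum_uminusI [OF this]]
      moreover have "(\<lambda>n. (norm (coord ?y n))\<^sup>2)
          = (\<lambda>n. (norm (coord x n))\<^sup>2 + - (if n \<in> F then (norm (coord x n))\<^sup>2 else 0))"
        by (auto simp: coord_simps sum_coord [OF elim(2)])
      ultimately have "((\<lambda>n. (norm (coord ?y n))\<^sup>2) has_sum (S - (\<Sum>n\<in>F. (norm (coord x n))\<^sup>2))) UNIV"
        by simp
      then have "(norm ?y)\<^sup>2 = S - (\<Sum>n\<in>F. (norm (coord x n))\<^sup>2)"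
        unfolding norm_ell2Z_squared by (rule infsumI)
      also have "\<dots> < e\<^sup>2"
        using elim(1) by (simp add: dist_real_def abs_less_iff)
      finally have "norm ?y < e"
        using e by (simp add: power_less_imp_less_base)
      then show ?case by (simp add: dist_norm norm_minus_commute)
    qed
  qed
  then show ?thesis unfolding has_sum_def .
qed

text \<open>Consistency with the action of an operator matrix: \<open>(U x)_i = (\<Sum>j. U_i_j x_j)\<close>.\<close>

lemma entry_has_sum:
  assumes "bounded_clinear U"
  shows "((\<lambda>j. entry U i j (coord x j)) has_sum coord (U x) i) UNIV"
proof -
  have "bounded_linear (\<lambda>x. coord (U x) i)"
    using assms bounded_clinear_coord [of i] bounded_linear_compose [of "\<lambda>x. coord x i" U]
    unfolding bounded_clinear_def by auto
  from has_sum_bounded_linear [OF this single_has_sum [of x]]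
  show ?thesis by (simp add: entry_def)
qed

end

theory Submission
  imports Defs
begin

text \<open>
  Put \<open>A = U\<^sub>n\<^sub>,\<^sub>n\<^sub>+\<^sub>k\<^sub>1\<close> and \<open>B = U\<^sub>n\<^sub>,\<^sub>n\<^sub>+\<^sub>k\<^sub>2\<close>. The columns \<open>n + k\<^sub>1\<close> and \<open>n + k\<^sub>2\<close> of \<open>U\<close> have only the
  row \<open>n\<close> in common, so their orthogonality says \<open>B\<^sup>*A = 0\<close>. The \<open>(n, n)\<close> entry of \<open>U U\<^sup>* = I\<close> is
  \<open>A A\<^sup>* + B B\<^sup>* = I\<close>. Multiplying by \<open>A\<close> from the right gives \<open>A A\<^sup>* A = A\<close>, which characterises
  partial isometries. The argument is symmetric in \<open>k\<^sub>1\<close> and \<open>k\<^sub>2\<close>.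
\<close>

lemma cinner_zero_left [simp]: "cinner 0 x = 0"
  using cinner_add_left [of 0 0 x] by simp

lemma cinner_zero_right [simp]: "cinner x 0 = 0"
  using cinner_add_right [of x 0 0] by simp

lemma cinner_self_eq_0_iff: "cinner x x = 0 \<longleftrightarrow> x = 0"
  by (simp add: cinner_self)

lemma cinner_diff_left: "cinner (x - y) z = cinner x z - cinner y z"
  using cinner_add_left [of "x - y" y z] by simp

lemma cinner_commute_eq_0: "cinner x y = 0 \<longleftrightarrow> cinner y x = 0"
  by (metis cinner_commute complex_cnj_zero)

lemma is_adjointD: "is_adjoint A B \<Longrightarrow> cinner (A x) y = cinner x (B y)"
  by (simp add: is_adjoint_def)

lemma is_adjoint_commute: "is_adjoint A B \<longleftrightarrow> is_adjoint B A"
  unfolding is_adjoint_def by (metis cinner_commute)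

lemma cinner_single_right: "cinner x (ell2Z_single i w) = cinner (coord x i) w"
proof -
  have "((\<lambda>n. cinner (coord x n) (coord (ell2Z_single i w) n)) has_sum cinner (coord x i) w) UNIV"
    by (rule has_sum_finite_neutralI [of "{i}"]) (auto simp: ell2Z_single.rep_eq)
  then show ?thesis
    by (simp add: cinner_ell2Z_def infsumI)
qed

text \<open>Pairing \<open>U\<close> with vectors supported at one index on each side isolates a
  single entry, so the matrix of the adjoint is the conjugate transpose.\<close>

lemma is_adjoint_entry:
  assumes "is_adjoint U V"
  shows "is_adjoint (entry U i j) (entry V j i)"
  unfolding is_adjoint_def
proof (intro allI)
  fix v w
  have "cinner (entry U i j v) w = cinner (ell2Z_single j v) (V (ell2Z_single i w))"
    using is_adjointD [OF assms] by (simp add: entry_def flip: cinner_single_right)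
  also have "\<dots> = cinner v (entry V j i w)"
    using cinner_single_right [of "V (ell2Z_single i w)" j v]
    by (metis cinner_commute entry_def)
  finally show "cinner (entry U i j v) w = cinner v (entry V j i w)" .
qed

text \<open>For \<open>x\<close> orthogonal to the kernel of \<open>A\<close>, the vector
  \<open>B (A x) - x\<close> lies in the kernel and is orthogonal to it, hence vanishes.\<close>

lemma partial_isometryI:
  assumes A: "bounded_clinear A" and adj: "is_adjoint A B" and ABA: "\<And>x. A (B (A x)) = A x"
  shows "partial_isometry A"
  unfolding partial_isometry_def
proof (intro conjI ballI A)
  fix x assume x: "x \<in> orth_complement (op_kernel A)"
  let ?z = "B (A x) - x"
  have ker: "A ?z = 0"
    using A ABA by (simp add: bounded_clinear_def bounded_linear.linear linear_diff)
  \<comment> \<open>The range of the adjoint \<open>B\<close> is orthogonal to the kernel of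
    \<open>A\<close>.\<close>
  have "cinner (B (A x)) ?z = cinner (A x) (A ?z)"
    using adj is_adjointD is_adjoint_commute by metis
  then have "cinner ?z ?z = 0"
    using x ker by (subst cinner_diff_left) (simp add: orth_complement_def op_kernel_def)
  then have "B (A x) = x"
    by (simp add: cinner_self_eq_0_iff)
  then have "cinner (A x) (A x) = cinner x x"
    by (simp add: is_adjointD [OF adj])
  then show "norm (A x) = norm x"
    by (simp add: cinner_self flip: of_real_power)
qed

lemma two_diagonal_orth_ranges:
  assumes adj: "is_adjoint U V" and VU: "V \<circ> U = id" and ne: "k1 \<noteq> k2"
    and diag: "\<And>i j. j - i \<notin> {k1, k2} \<Longrightarrow> entry U i j = (\<lambda>_. 0)"
  shows "cinner (entry U n (n + k1) v) (entry U n (n + k2) w) = 0"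
proof -
  let ?e = "ell2Z_single (n + k1) v" and ?f = "ell2Z_single (n + k2) w"
  have "((\<lambda>i. cinner (coord (U ?e) i) (coord (U ?f) i)) has_sum
      cinner (entry U n (n + k1) v) (entry U n (n + k2) w)) UNIV"
  proof (rule has_sum_finite_neutralI [of "{n}"])
    fix i assume "i \<in> UNIV - {n}"
    \<comment> \<open>Away from row \<open>n\<close>, the first column can be nonzero only in row
      \<open>n + k1 - k2\<close>, the second only in row \<open>n + k2 - k1\<close>; these rows
      differ.\<close>
    then have "n + k1 - i \<notin> {k1, k2} \<or> n + k2 - i \<notin> {k1, k2}"
      using ne by auto
    then show "cinner (coord (U ?e) i) (coord (U ?f) i) = 0"
      using diag [of "n + k1" i] diag [of "n + k2" i] by (auto simp: entry_def fun_eq_iff)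
  qed (simp_all add: entry_def)
  then have "cinner (entry U n (n + k1) v) (entry U n (n + k2) w) = cinner (U ?e) (U ?f)"
    by (simp add: cinner_ell2Z_def infsumI)
  also have "\<dots> = cinner ?e (V (U ?f))"
    using adj by (rule is_adjointD)
  also have "\<dots> = cinner ?e ?f"
    using VU by (simp add: fun_eq_iff)
  also have "\<dots> = 0"
    using ne by (simp add: cinner_single_right ell2Z_single.rep_eq)
  finally show ?thesis .
qed

text \<open>Row \<open>n\<close> of \<open>U\<close> is supported on two columns, so the series for
  coordinate \<open>n\<close> of \<open>U (V (ell2Z_single n w))\<close> collapses to two
  terms.\<close>

lemma two_diagonal_entry_sum:
  assumes U: "bounded_clinear U" and UV: "U \<circ> V = id" and ne: "k1 \<noteq> k2"
    and diag: "\<And>i j. j - i \<notin> {k1, k2} \<Longrightarrow> entry U i j = (\<lambda>_. 0)"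
  shows "entry U n (n + k1) (entry V (n + k1) n w) + entry U n (n + k2) (entry V (n + k2) n w) = w"
proof -
  let ?x = "V (ell2Z_single n w)"
  have "((\<lambda>j. entry U n j (coord ?x j)) has_sum
      (\<Sum>j\<in>{n + k1, n + k2}. entry U n j (coord ?x j))) UNIV"
  proof (rule has_sum_finite_neutralI)
    fix j assume "j \<in> UNIV - {n + k1, n + k2}"
    then show "entry U n j (coord ?x j) = 0"
      using diag [of j n] by auto
  qed simp_all
  then have "(\<Sum>j\<in>{n + k1, n + k2}. entry U n j (coord ?x j)) = coord (U ?x) n"
    using entry_has_sum [OF U, of n ?x] has_sum_unique by blast
  also have "\<dots> = w"
    using UV by (simp add: fun_eq_iff ell2Z_single.rep_eq)
  finally show ?thesis
    using ne by (simp add: entry_def)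
qed

lemma two_diagonal_partial_isometry:
  assumes U: "bounded_clinear U" and adj: "is_adjoint U V"
    and VU: "V \<circ> U = id" and UV: "U \<circ> V = id" and ne: "k1 \<noteq> k2"
    and diag: "\<And>i j. j - i \<notin> {k1, k2} \<Longrightarrow> entry U i j = (\<lambda>_. 0)"
  shows "partial_isometry (entry U n (n + k1))"
proof (rule partial_isometryI)
  let ?A = "entry U n (n + k1)" and ?A' = "entry V (n + k1) n"
  let ?B = "entry U n (n + k2)" and ?B' = "entry V (n + k2) n"
  show "bounded_clinear ?A"
    using U by (rule bounded_clinear_entry)
  show "is_adjoint ?A ?A'"
    using adj by (rule is_adjoint_entry)
  fix x
  \<comment> \<open>Orthogonality of the ranges is used at the vector \<open>?B' (?A x)\<close>;
    moving \<open>?B\<close> across then gives this vector norm zero.\<close>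
  have "cinner (?B (?B' (?A x))) (?A x) = 0"
    using two_diagonal_orth_ranges [OF adj VU ne diag] cinner_commute_eq_0 by blast
  then have "?B' (?A x) = 0"
    using is_adjointD [OF is_adjoint_entry [OF adj]] cinner_self_eq_0_iff by metis
  moreover have "?B 0 = 0"
    using bounded_clinear_entry [OF U]
    by (simp add: bounded_clinear_def bounded_linear.linear linear_0)
  ultimately show "?A (?A' (?A x)) = ?A x"
    using two_diagonal_entry_sum [OF U UV ne diag, of n "?A x"] by simp
qed

theorem proposition3p2:
  fixes U :: "'h::chilbert_space ell2Z \<Rightarrow> 'h ell2Z"
    and k1 k2 :: int
  assumes "\<exists>v::'h. v \<noteq> 0"
    and "unitary_op U"
    and "k1 \<noteq> k2"
    and "\<And>n. entry U n (n + k1) \<noteq> (\<lambda>_. 0)"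
    and "\<And>n. entry U n (n + k2) \<noteq> (\<lambda>_. 0)"
    and "\<And>i j. j - i \<notin> {k1, k2} \<Longrightarrow> entry U i j = (\<lambda>_. 0)"
  shows "\<forall>n. partial_isometry (entry U n (n + k1))
           \<and> partial_isometry (entry U n (n + k2))
           \<and> orth_sets (range (entry U n (n + k1))) (range (entry U n (n + k2)))"
proof -
  obtain V where U: "bounded_clinear U" and adj: "is_adjoint U V"
    and VU: "V \<circ> U = id" and UV: "U \<circ> V = id"
    using assms(2) unfolding unitary_op_def by blast
  \<comment> \<open>The swapped form lets the second diagonal be handled by exchanging
    \<open>k1\<close> and \<open>k2\<close>.\<close>
  have diag: "entry U i j = (\<lambda>_. 0)" if "j - i \<notin> {k2, k1}" for i j
    using assms(6) that by blast
  show ?thesis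
    using two_diagonal_partial_isometry [OF U adj VU UV assms(3,6)]
      two_diagonal_partial_isometry [OF U adj VU UV assms(3) [symmetric] diag]
      two_diagonal_orth_ranges [OF adj VU assms(3,6)]
    by (auto simp: orth_sets_def)
qed

end
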